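(* Let $\mathbf{A}$ be a category and let $\mathcal{M}\subseteq\mathsf{Mono}(\mathbf{A})$, $\mathcal{N}\subseteq\mathsf{Mor}(\mathbf{A})$ be classes satisfying conditions (i)–(iii) below. Let $F=\{F_j\}_{j\in J}$ be a non-empty family of functors $F_j:\mathbf{A}\to\mathbf{B}_j$, where each $\mathbf{B}_j$ is $\mathcal{M}_j,\mathcal{N}_j$-adhesive. \begin{enumerate} \item Suppose every $F_j$ preserves pullbacks, $F_j(\mathcal{M})\subseteq\mathcal{M}_j$ and $F_j(\mathcal{N})\subseteq\mathcal{N}_j$ for every $j\in J$, $F$ jointly preserves $\mathcal{M},\mathcal{N}$-pushouts, and $F$ jointly reflects pushout squares of the following kind: a commutative square in $\mathbf{A}$ with arrows $f:A\to B$, $m:A\to C$, $n:B\to D$, $g:C\to D$ (with $n\circ f=g\circ m$), where $m,n\in\mathcal{M}$ and $f\in\mathcal{N}$, is a pushout in $\mathbf{A}$ whenever, for every $j\in J$, the square $F_j(f),F_j(m),F_j(n),F_j(g)$ is a pushout in $\mathbf{B}_j$. Then $\mathcal{M},\mathcal{N}$-pushouts in $\mathbf{A}$ are stable. If moreover $F$ jointly reflects $\mathcal{M}$-pullbacks and $\mathcal{N}$-pullbacks, then $\mathcal{M},\mathcal{N}$-pushouts in $\mathbf{A}$ are Van Kampen squares. \item If $F$ satisfies all the assumptions of item 1 (including the additional ones) and jointly creates both $\mathcal{M}$-pullbacks and $\mathcal{N}$-pullbacks, then $\mathbf{A}$ is $\mathcal{M},\mathcal{N}$-adhesive. \item If $F$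 jointly creates all pushouts and all pullbacks, then $\mathbf{A}$ is $\mathcal{M}_F,\mathcal{N}_F$-adhesive, where $\mathcal{M}_F=\{m\in\mathsf{Mor}(\mathbf{A})\mid F_j(m)\in\mathcal{M}_j\text{ for every }j\in J\}$ and $\mathcal{N}_F=\{n\in\mathsf{Mor}(\mathbf{A})\mid F_j(n)\in\mathcal{N}_j\text{ for every }j\in J\}$. \end{enumerate}
   Context: For a category $\mathbf{A}$, $\mathsf{Mor}(\mathbf{A})$, $\mathsf{Mono}(\mathbf{A})$ denote its arrows and monomorphisms. Consider commutative squares with $f:A\to B$, $m:A\to C$, $n:B\to D$, $g:C\to D$. A class $\mathcal{X}$ of arrows is stable under pushouts if, for every such pushout square, $m\in\mathcal{X}$ implies $n\in\mathcal{X}$; stable under pullbacks if, for every such pullback square, $n\in\mathcal{X}$ implies $m\in\mathcal{X}$; closed under $\mathcal{Y}$-decomposition if $g\circ f\in\mathcal{X}$ and $g\in\mathcal{Y}$ imply $f\in\mathcal{X}$; closed under decomposition if closed under $\mathcal{X}$-decomposition. Conditions: (i) $\mathcal{M}$ and $\mathcal{N}$ contain all isomorphisms and are closed under composition and decomposition; (ii) $\mathcal{N}$ is closed under $\mathcal{M}$-decomposition; (iii) $\mathcal{M}$ and $\mathcal{N}$ are stable under pullbacks and pushouts. A pushout square is a Van Kampen square if, for every commutative cube having it as bottom face and whose two vertical faces containing the vertical arrow over $A$ are pullbacks, the top face is a pushout if and only if the other two vertical faces are pullbacks; it is stable if the "if" direction holds (whenever all four vertical faces are pullbacks, the top face is a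 pushout). Given $\mathcal{M}\subseteq\mathsf{Mono}(\mathbf{A})$, $\mathcal{N}\subseteq\mathsf{Mor}(\mathbf{A})$ satisfying (i)–(iii), $\mathbf{A}$ is $\mathcal{M},\mathcal{N}$-adhesive if (a) every cospan $C\xrightarrow{g}D\xleftarrow{m}B$ with $m\in\mathcal{M}$ has a pullback ($\mathcal{M}$-pullbacks); (b) every span $C\xleftarrow{m}A\xrightarrow{n}B$ with $m\in\mathcal{M}$, $n\in\mathcal{N}$ has a pushout ($\mathcal{M},\mathcal{N}$-pushouts); (c) $\mathcal{M},\mathcal{N}$-pushouts are Van Kampen squares. $\mathcal{N}$-pullbacks are pullbacks of cospans with one leg in $\mathcal{N}$. For a diagram $I:\mathbf{I}\to\mathbf{A}$ and family $F=\{F_j\}$: $F$ jointly preserves (co)limits of $I$ if for every (co)limiting (co)cone $(L,l_i)$ for $I$ each $(F_j(L),F_j(l_i))$ is (co)limiting for $F_j\circ I$; jointly reflects (co)limits of $I$ if a (co)cone $(L,l_i)$ for $I$ is (co)limiting whenever every $(F_j(L),F_j(l_i))$ is (co)limiting for $F_j\circ I$; jointly lifts (co)limits of $I$ if, given (co)limiting (co)cones $(L_j,l_{j,i})$ for each $F_j\circ I$, there is a (co)limiting (co)cone $(L,l_i)$ for $I$ with $(F_j(L),F_j(l_i))=(L_j,l_{j,i})$ for all $j$; jointly creates (co)limits of $I$ if $I$ has a (co)limit and $F$ jointly preserves and reflects (co)limits of $I$. Applied to a class of diagrams (e.g. "$\mathcal{M},\mathcal{N}$-pushouts", i.e. spans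 with one leg in $\mathcal{M}$ and the other in $\mathcal{N}$), these mean: for every such diagram.
   Formalization: Item 2 is proved under the added assumption that A has M,N-pushouts (every span with one leg in M and the other in N has a pushout); without it item 2 fails, since preservation and reflection do not give existence. *)

theory Defs
  imports Main
begin

text \<open>A category is given by explicit sets of objects and arrows, so that
  categories of different sizes can live over the same pair of types.\<close>

record ('o, 'a) cat =
  Ob :: "'o set"
  Arr :: "'a set"
  Dom :: "'a \<Rightarrow> 'o"
  Cod :: "'a \<Rightarrow> 'o"
  Id :: "'o \<Rightarrow> 'a"
  Comp :: "'a \<Rightarrow> 'a \<Rightarrow> 'a"  \<comment> \<open>\<open>Comp C g f\<close> is \<open>g\<close> after \<open>f\<close>\<close>

definition hom :: "('o, 'a) cat \<Rightarrow> 'o \<Rightarrow> 'o \<Rightarrow> 'a set" where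
  "hom C x y = {f \<in> Arr C. Dom C f = x \<and> Cod C f = y}"

locale category =
  fixes C :: "('o, 'a) cat"
  assumes dom_in_Ob: "f \<in> Arr C \<Longrightarrow> Dom C f \<in> Ob C"
    and cod_in_Ob: "f \<in> Arr C \<Longrightarrow> Cod C f \<in> Ob C"
    and Id_in_hom: "x \<in> Ob C \<Longrightarrow> Id C x \<in> hom C x x"
    and Comp_in_hom: "f \<in> hom C x y \<Longrightarrow> g \<in> hom C y z \<Longrightarrow> Comp C g f \<in> hom C x z"
    and Comp_Id: "f \<in> hom C x y \<Longrightarrow> Comp C f (Id C x) = f"
    and Id_Comp: "f \<in> hom C x y \<Longrightarrow> Comp C (Id C y) f = f"
    and Comp_assoc: "f \<in> hom C w x \<Longrightarrow> g \<in> hom C x y \<Longrightarrow> h \<in> hom C y z \<Longrightarrow>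
      Comp C h (Comp C g f) = Comp C (Comp C h g) f"

record ('o, 'a, 'p, 'b) cat_map =
  obj_map :: "'o \<Rightarrow> 'p"
  arr_map :: "'a \<Rightarrow> 'b"

locale cat_functor = A: category A + B: category B
  for A :: "('o, 'a) cat" and B :: "('p, 'b) cat" +
  fixes F :: "('o, 'a, 'p, 'b) cat_map"
  assumes map_Ob: "x \<in> Ob A \<Longrightarrow> obj_map F x \<in> Ob B"
    and map_hom: "f \<in> hom A x y \<Longrightarrow> arr_map F f \<in> hom B (obj_map F x) (obj_map F y)"
    and map_Id: "x \<in> Ob A \<Longrightarrow> arr_map F (Id A x) = Id B (obj_map F x)"
    and map_Comp: "f \<in> hom A x y \<Longrightarrow> g \<in> hom A y z \<Longrightarrow>
      arr_map F (Comp A g f) = Comp B (arr_map F g) (arr_map F f)"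

definition isomorphisms :: "('o, 'a) cat \<Rightarrow> 'a set" where
  "isomorphisms C = {f \<in> Arr C. \<exists>g \<in> hom C (Cod C f) (Dom C f).
     Comp C g f = Id C (Dom C f) \<and> Comp C f g = Id C (Cod C f)}"

definition monomorphisms :: "('o, 'a) cat \<Rightarrow> 'a set" where
  "monomorphisms C = {m \<in> Arr C. \<forall>u \<in> Arr C. \<forall>v \<in> Arr C.
     Dom C u = Dom C v \<and> Cod C u = Dom C m \<and> Cod C v = Dom C m \<and> Comp C m u = Comp C m v
       \<longrightarrow> u = v}"

text \<open>All squares below are listed as \<open>f m n g\<close> with
  \<open>f : A \<rightarrow> B\<close>, \<open>m : A \<rightarrow> C\<close>, \<open>n : B \<rightarrow> D\<close>, \<open>g : C \<rightarrow> D\<close>,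
  so \<open>n\<close> is opposite to \<open>m\<close> and \<open>g\<close> is opposite to \<open>f\<close>.\<close>

definition comm_square :: "('o, 'a) cat \<Rightarrow> 'a \<Rightarrow> 'a \<Rightarrow> 'a \<Rightarrow> 'a \<Rightarrow> bool" where
  "comm_square C f m n g \<longleftrightarrow>
     f \<in> Arr C \<and> m \<in> Arr C \<and> n \<in> Arr C \<and> g \<in> Arr C \<and>
     Dom C f = Dom C m \<and> Cod C f = Dom C n \<and> Cod C m = Dom C g \<and> Cod C n = Cod C g \<and>
     Comp C n f = Comp C g m"

definition pushout :: "('o, 'a) cat \<Rightarrow> 'a \<Rightarrow> 'a \<Rightarrow> 'a \<Rightarrow> 'a \<Rightarrow> bool" where
  "pushout C f m n g \<longleftrightarrow> comm_square C f m n g \<and>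
     (\<forall>n' g'. comm_square C f m n' g' \<longrightarrow>
        (\<exists>!u. u \<in> hom C (Cod C n) (Cod C n') \<and> Comp C u n = n' \<and> Comp C u g = g'))"

definition pullback :: "('o, 'a) cat \<Rightarrow> 'a \<Rightarrow> 'a \<Rightarrow> 'a \<Rightarrow> 'a \<Rightarrow> bool" where
  "pullback C f m n g \<longleftrightarrow> comm_square C f m n g \<and>
     (\<forall>f' m'. comm_square C f' m' n g \<longrightarrow>
        (\<exists>!u. u \<in> hom C (Dom C f') (Dom C f) \<and> Comp C f u = f' \<and> Comp C m u = m'))"

definition stable_under_pushouts :: "('o, 'a) cat \<Rightarrow> 'a set \<Rightarrow> bool" where
  "stable_under_pushouts C X \<longleftrightarrow> (\<forall>f m n g. pushout C f m n g \<longrightarrow> m \<in> X \<longrightarrow> n \<in> X)"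

definition stable_under_pullbacks :: "('o, 'a) cat \<Rightarrow> 'a set \<Rightarrow> bool" where
  "stable_under_pullbacks C X \<longleftrightarrow> (\<forall>f m n g. pullback C f m n g \<longrightarrow> n \<in> X \<longrightarrow> m \<in> X)"

definition closed_under_composition :: "('o, 'a) cat \<Rightarrow> 'a set \<Rightarrow> bool" where
  "closed_under_composition C X \<longleftrightarrow>
     (\<forall>f \<in> Arr C. \<forall>g \<in> Arr C. Cod C f = Dom C g \<longrightarrow> f \<in> X \<longrightarrow> g \<in> X \<longrightarrow> Comp C g f \<in> X)"

definition closed_under_decomposition_by :: "('o, 'a) cat \<Rightarrow> 'a set \<Rightarrow> 'a set \<Rightarrow> bool" where
  "closed_under_decomposition_by C Y X \<longleftrightarrow>
     (\<forall>f \<in> Arr C. \<forall>g \<in> Arr C. Cod C f = Dom C g \<longrightarrow> Comp C g f \<in> X \<longrightarrow> g \<in> Y \<longrightarrow> f \<in> X)"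

abbreviation closed_under_decomposition :: "('o, 'a) cat \<Rightarrow> 'a set \<Rightarrow> bool" where
  "closed_under_decomposition C X \<equiv> closed_under_decomposition_by C X X"

definition admissible_classes :: "('o, 'a) cat \<Rightarrow> 'a set \<Rightarrow> 'a set \<Rightarrow> bool" where
  "admissible_classes C M N \<longleftrightarrow>
     M \<subseteq> monomorphisms C \<and> N \<subseteq> Arr C \<and>
     isomorphisms C \<subseteq> M \<and> isomorphisms C \<subseteq> N \<and>
     closed_under_composition C M \<and> closed_under_composition C N \<and>
     closed_under_decomposition C M \<and> closed_under_decomposition C N \<and>
     closed_under_decomposition_by C M N \<and>
     stable_under_pullbacks C M \<and> stable_under_pullbacks C N \<and>
     stable_under_pushouts C M \<and> stable_under_pushouts C N"

text \<open>The bottom face is \<open>f m n g\<close>, the top face is \<open>f' m' n' g'\<close>, and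
  \<open>a : A' \<rightarrow> A\<close>, \<open>b : B' \<rightarrow> B\<close>, \<open>c : C' \<rightarrow> C\<close>, \<open>d : D' \<rightarrow> D\<close> are the vertical arrows.\<close>

definition comm_cube ::
  "('o, 'a) cat \<Rightarrow> 'a \<Rightarrow> 'a \<Rightarrow> 'a \<Rightarrow> 'a \<Rightarrow> 'a \<Rightarrow> 'a \<Rightarrow> 'a \<Rightarrow> 'a \<Rightarrow> 'a \<Rightarrow> 'a \<Rightarrow> 'a \<Rightarrow> 'a \<Rightarrow> bool" where
  "comm_cube C f m n g f' m' n' g' a b c d \<longleftrightarrow>
     comm_square C f m n g \<and> comm_square C f' m' n' g' \<and>
     comm_square C f' a b f \<and> comm_square C m' a c m \<and>
     comm_square C n' b d n \<and> comm_square C g' c d g"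

definition van_kampen :: "('o, 'a) cat \<Rightarrow> 'a \<Rightarrow> 'a \<Rightarrow> 'a \<Rightarrow> 'a \<Rightarrow> bool" where
  "van_kampen C f m n g \<longleftrightarrow> pushout C f m n g \<and>
     (\<forall>f' m' n' g' a b c d.
        comm_cube C f m n g f' m' n' g' a b c d \<longrightarrow>
        pullback C f' a b f \<longrightarrow> pullback C m' a c m \<longrightarrow>
        (pushout C f' m' n' g' \<longleftrightarrow> pullback C n' b d n \<and> pullback C g' c d g))"

definition stable_pushout :: "('o, 'a) cat \<Rightarrow> 'a \<Rightarrow> 'a \<Rightarrow> 'a \<Rightarrow> 'a \<Rightarrow> bool" where
  "stable_pushout C f m n g \<longleftrightarrow> pushout C f m n g \<and>
     (\<forall>f' m' n' g' a b c d.
        comm_cube C f m n g f' m' n' g' a b c d \<longrightarrow>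
        pullback C f' a b f \<longrightarrow> pullback C m' a c m \<longrightarrow>
        pullback C n' b d n \<longrightarrow> pullback C g' c d g \<longrightarrow>
        pushout C f' m' n' g')"

text \<open>A (co)cone over a span or cospan is the same thing as a
  completion to a commutative square, and it is (co)limiting iff the square is a pushout
  or a pullback.\<close>

definition spans :: "('o, 'a) cat \<Rightarrow> ('a \<times> 'a) set" where
  "spans C = {(f, m). f \<in> Arr C \<and> m \<in> Arr C \<and> Dom C f = Dom C m}"

definition cospans :: "('o, 'a) cat \<Rightarrow> ('a \<times> 'a) set" where
  "cospans C = {(n, g). n \<in> Arr C \<and> g \<in> Arr C \<and> Cod C n = Cod C g}"

definition MN_spans :: "('o, 'a) cat \<Rightarrow> 'a set \<Rightarrow> 'a set \<Rightarrow> ('a \<times> 'a) set" where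
  "MN_spans C M N = {(f, m) \<in> spans C. m \<in> M \<and> f \<in> N}"

definition leg_cospans :: "('o, 'a) cat \<Rightarrow> 'a set \<Rightarrow> ('a \<times> 'a) set" where
  "leg_cospans C X = {(n, g) \<in> cospans C. n \<in> X \<or> g \<in> X}"

definition has_pushouts :: "('o, 'a) cat \<Rightarrow> ('a \<times> 'a) set \<Rightarrow> bool" where
  "has_pushouts C S \<longleftrightarrow> (\<forall>(f, m) \<in> S. \<exists>n g. pushout C f m n g)"

definition has_pullbacks :: "('o, 'a) cat \<Rightarrow> ('a \<times> 'a) set \<Rightarrow> bool" where
  "has_pullbacks C S \<longleftrightarrow> (\<forall>(n, g) \<in> S. \<exists>f m. pullback C f m n g)"

definition adhesive :: "('o, 'a) cat \<Rightarrow> 'a set \<Rightarrow> 'a set \<Rightarrow> bool" where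
  "adhesive C M N \<longleftrightarrow>
     category C \<and> admissible_classes C M N \<and>
     has_pullbacks C (leg_cospans C M) \<and>
     has_pushouts C (MN_spans C M N) \<and>
     (\<forall>(f, m) \<in> MN_spans C M N. \<forall>n g. pushout C f m n g \<longrightarrow> van_kampen C f m n g)"

definition preserves_pullbacks ::
  "('o, 'a) cat \<Rightarrow> ('p, 'b) cat \<Rightarrow> ('o, 'a, 'p, 'b) cat_map \<Rightarrow> bool" where
  "preserves_pullbacks A B F \<longleftrightarrow> (\<forall>f m n g. pullback A f m n g \<longrightarrow>
     pullback B (arr_map F f) (arr_map F m) (arr_map F n) (arr_map F g))"

text \<open>Joint preservation, reflection and creation for the family of functors \<open>F j : A \<rightarrow> B j\<close>
  with \<open>j \<in> J\<close>, relative to a set \<open>S\<close> of spans or cospans of \<open>A\<close>. Preservation and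
  reflection do not assert that the (co)limits exist.\<close>

definition jointly_preserves_pushouts ::
  "'j set \<Rightarrow> ('o, 'a) cat \<Rightarrow> ('j \<Rightarrow> ('p, 'b) cat) \<Rightarrow> ('j \<Rightarrow> ('o, 'a, 'p, 'b) cat_map) \<Rightarrow>
    ('a \<times> 'a) set \<Rightarrow> bool" where
  "jointly_preserves_pushouts J A B F S \<longleftrightarrow>
     (\<forall>(f, m) \<in> S. \<forall>n g. pushout A f m n g \<longrightarrow>
        (\<forall>j \<in> J. pushout (B j) (arr_map (F j) f) (arr_map (F j) m)
                              (arr_map (F j) n) (arr_map (F j) g)))"

definition jointly_preserves_pullbacks ::
  "'j set \<Rightarrow> ('o, 'a) cat \<Rightarrow> ('j \<Rightarrow> ('p, 'b) cat) \<Rightarrow> ('j \<Rightarrow> ('o, 'a, 'p, 'b) cat_map) \<Rightarrow>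
    ('a \<times> 'a) set \<Rightarrow> bool" where
  "jointly_preserves_pullbacks J A B F S \<longleftrightarrow>
     (\<forall>(n, g) \<in> S. \<forall>f m. pullback A f m n g \<longrightarrow>
        (\<forall>j \<in> J. pullback (B j) (arr_map (F j) f) (arr_map (F j) m)
                               (arr_map (F j) n) (arr_map (F j) g)))"

definition jointly_reflects_pushouts ::
  "'j set \<Rightarrow> ('o, 'a) cat \<Rightarrow> ('j \<Rightarrow> ('p, 'b) cat) \<Rightarrow> ('j \<Rightarrow> ('o, 'a, 'p, 'b) cat_map) \<Rightarrow>
    ('a \<times> 'a) set \<Rightarrow> bool" where
  "jointly_reflects_pushouts J A B F S \<longleftrightarrow>
     (\<forall>(f, m) \<in> S. \<forall>n g. comm_square A f m n g \<longrightarrow>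
        (\<forall>j \<in> J. pushout (B j) (arr_map (F j) f) (arr_map (F j) m)
                              (arr_map (F j) n) (arr_map (F j) g)) \<longrightarrow>
        pushout A f m n g)"

definition jointly_reflects_pullbacks ::
  "'j set \<Rightarrow> ('o, 'a) cat \<Rightarrow> ('j \<Rightarrow> ('p, 'b) cat) \<Rightarrow> ('j \<Rightarrow> ('o, 'a, 'p, 'b) cat_map) \<Rightarrow>
    ('a \<times> 'a) set \<Rightarrow> bool" where
  "jointly_reflects_pullbacks J A B F S \<longleftrightarrow>
     (\<forall>(n, g) \<in> S. \<forall>f m. comm_square A f m n g \<longrightarrow>
        (\<forall>j \<in> J. pullback (B j) (arr_map (F j) f) (arr_map (F j) m)
                               (arr_map (F j) n) (arr_map (F j) g)) \<longrightarrow>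
        pullback A f m n g)"

definition jointly_creates_pushouts ::
  "'j set \<Rightarrow> ('o, 'a) cat \<Rightarrow> ('j \<Rightarrow> ('p, 'b) cat) \<Rightarrow> ('j \<Rightarrow> ('o, 'a, 'p, 'b) cat_map) \<Rightarrow>
    ('a \<times> 'a) set \<Rightarrow> bool" where
  "jointly_creates_pushouts J A B F S \<longleftrightarrow>
     has_pushouts A S \<and> jointly_preserves_pushouts J A B F S \<and> jointly_reflects_pushouts J A B F S"

definition jointly_creates_pullbacks ::
  "'j set \<Rightarrow> ('o, 'a) cat \<Rightarrow> ('j \<Rightarrow> ('p, 'b) cat) \<Rightarrow> ('j \<Rightarrow> ('o, 'a, 'p, 'b) cat_map) \<Rightarrow>
    ('a \<times> 'a) set \<Rightarrow> bool" where
  "jointly_creates_pullbacks J A B F S \<longleftrightarrow>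
     has_pullbacks A S \<and> jointly_preserves_pullbacks J A B F S \<and> jointly_reflects_pullbacks J A B F S"

text \<open>The hypotheses on the family under which \<open>M, N\<close>-pushouts are stable. The last clause
  concerns squares in which also the arrow \<open>n\<close> opposite to \<open>m\<close> is in \<open>M\<close>.\<close>

definition stability_hypotheses ::
  "'j set \<Rightarrow> ('o, 'a) cat \<Rightarrow> 'a set \<Rightarrow> 'a set \<Rightarrow> ('j \<Rightarrow> ('p, 'b) cat) \<Rightarrow> ('j \<Rightarrow> 'b set) \<Rightarrow>
    ('j \<Rightarrow> 'b set) \<Rightarrow> ('j \<Rightarrow> ('o, 'a, 'p, 'b) cat_map) \<Rightarrow> bool" where
  "stability_hypotheses J A M N B MB NB F \<longleftrightarrow>
     (\<forall>j \<in> J. preserves_pullbacks A (B j) (F j)) \<and>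
     (\<forall>j \<in> J. arr_map (F j) ` M \<subseteq> MB j) \<and>
     (\<forall>j \<in> J. arr_map (F j) ` N \<subseteq> NB j) \<and>
     jointly_preserves_pushouts J A B F (MN_spans A M N) \<and>
     (\<forall>f m n g. comm_square A f m n g \<longrightarrow> m \<in> M \<longrightarrow> n \<in> M \<longrightarrow> f \<in> N \<longrightarrow>
        (\<forall>j \<in> J. pushout (B j) (arr_map (F j) f) (arr_map (F j) m)
                              (arr_map (F j) n) (arr_map (F j) g)) \<longrightarrow>
        pushout A f m n g)"

definition reflects_MN_pullbacks ::
  "'j set \<Rightarrow> ('o, 'a) cat \<Rightarrow> 'a set \<Rightarrow> 'a set \<Rightarrow> ('j \<Rightarrow> ('p, 'b) cat) \<Rightarrow>
    ('j \<Rightarrow> ('o, 'a, 'p, 'b) cat_map) \<Rightarrow> bool" where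
  "reflects_MN_pullbacks J A M N B F \<longleftrightarrow>
     jointly_reflects_pullbacks J A B F (leg_cospans A M) \<and>
     jointly_reflects_pullbacks J A B F (leg_cospans A N)"

end

theory Submission
  imports Defs
begin

text \<open>Images under the \<open>F j\<close> turn a cube over an \<open>M, N\<close>-pushout of \<open>A\<close> into a
  cube over an \<open>MB j, NB j\<close>-pushout, which is Van Kampen in \<open>B j\<close>, and the conclusion is
  reflected back to \<open>A\<close>: the top face of the cube is a square of the kind for which pushouts
  are reflected because \<open>M\<close> and \<open>N\<close> are stable under pushouts and pullbacks, and its front faces
  are completions of cospans with a leg in \<open>M\<close> or in \<open>N\<close>. The classes \<open>M\<^sub>F\<close> and \<open>N\<^sub>F\<close> inherit the
  closure properties from the \<open>B j\<close>; they consist of monomorphisms since being mono is expressed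
  by a pullback square.\<close>

section \<open>Transposed squares, stability along either pair of sides, and monomorphisms as
  pullbacks\<close>

lemma comm_square_sym: "comm_square C f m n g \<longleftrightarrow> comm_square C m f g n"
  unfolding comm_square_def by auto

text \<open>Transposing a square only exchanges the two components of a cone, so the same mediating
  arrow serves.\<close>

lemma pullback_sym:
  assumes "pullback C f m n g"
  shows "pullback C m f g n"
  unfolding pullback_def
proof (intro conjI allI impI)
  have "comm_square C f m n g"
    using assms by (simp add: pullback_def)
  then show "comm_square C m f g n"
    by (simp add: comm_square_sym)
  fix f' m'
  assume "comm_square C f' m' g n"
  then have "comm_square C m' f' n g"
    by (simp add: comm_square_sym)
  \<comment> \<open>The universal property names the domain of the first leg only; equal domains of
    both legs make the two hom-sets coincide.\<close>
  moreover from this have "Dom C m' = Dom C f'"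
    by (simp add: comm_square_def)
  moreover have "Dom C f = Dom C m"
    using \<open>comm_square C f m n g\<close> by (simp add: comm_square_def)
  moreover have "\<exists>!u. u \<in> hom C (Dom C m') (Dom C f) \<and> Comp C f u = m' \<and> Comp C m u = f'"
    using assms calculation(1) by (simp add: pullback_def)
  ultimately show "\<exists>!u. u \<in> hom C (Dom C f') (Dom C m) \<and> Comp C m u = f' \<and> Comp C f u = m'"
    by (simp add: conj_ac)
qed

lemma pushout_sym:
  assumes "pushout C f m n g"
  shows "pushout C m f g n"
  unfolding pushout_def
proof (intro conjI allI impI)
  have "comm_square C f m n g"
    using assms by (simp add: pushout_def)
  then show "comm_square C m f g n"
    by (simp add: comm_square_sym)
  fix n' g'
  assume "comm_square C m f n' g'"
  then have "comm_square C f m g' n'"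
    by (simp add: comm_square_sym)
  moreover from this have "Cod C g' = Cod C n'"
    by (simp add: comm_square_def)
  moreover have "Cod C n = Cod C g"
    using \<open>comm_square C f m n g\<close> by (simp add: comm_square_def)
  moreover have "\<exists>!u. u \<in> hom C (Cod C n) (Cod C g') \<and> Comp C u n = g' \<and> Comp C u g = n'"
    using assms calculation(1) by (simp add: pushout_def)
  ultimately show "\<exists>!u. u \<in> hom C (Cod C g) (Cod C n') \<and> Comp C u g = n' \<and> Comp C u n = g'"
    by (simp add: conj_ac)
qed

lemma comm_square_spans: "comm_square C f m n g \<Longrightarrow> (f, m) \<in> spans C"
  by (simp add: comm_square_def spans_def)

lemma comm_square_cospans: "comm_square C f m n g \<Longrightarrow> (n, g) \<in> cospans C"
  by (simp add: comm_square_def cospans_def)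

lemma pullback_comm_square: "pullback C f m n g \<Longrightarrow> comm_square C f m n g"
  by (simp add: pullback_def)

lemma pushout_comm_square: "pushout C f m n g \<Longrightarrow> comm_square C f m n g"
  by (simp add: pushout_def)

text \<open>Stability is defined for one pair of opposite sides. Transposition supplies the other
  pair, which is the one met in the faces of a cube.\<close>

lemma pullback_stable:
  assumes "stable_under_pullbacks C X" "pullback C f m n g"
  shows "n \<in> X \<Longrightarrow> m \<in> X" and "g \<in> X \<Longrightarrow> f \<in> X"
  using assms pullback_sym[OF assms(2)] unfolding stable_under_pullbacks_def by blast+

lemma pushout_stable:
  assumes "stable_under_pushouts C X" "pushout C f m n g"
  shows "m \<in> X \<Longrightarrow> n \<in> X" and "f \<in> X \<Longrightarrow> g \<in> X"
  using assms pushout_sym[OF assms(2)] unfolding stable_under_pushouts_def by blast+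

text \<open>The kernel pair of a monomorphism is trivial. As a limit condition, being mono can be
  reflected together with pullbacks.\<close>

lemma (in category) mono_iff_pullback:
  assumes m: "m \<in> Arr C"
  shows "m \<in> monomorphisms C \<longleftrightarrow> pullback C (Id C (Dom C m)) (Id C (Dom C m)) m m"
    (is "_ \<longleftrightarrow> pullback C ?i ?i m m")
proof
  assume mono: "m \<in> monomorphisms C"
  have i: "?i \<in> hom C (Dom C m) (Dom C m)"
    using Id_in_hom dom_in_Ob m by blast
  have sq: "comm_square C ?i ?i m m"
    using i m by (auto simp: comm_square_def hom_def)
  have "\<exists>!u. u \<in> hom C (Dom C f) (Dom C ?i) \<and> Comp C ?i u = f \<and> Comp C ?i u = g"
    if fg: "comm_square C f g m m" for f g
  proof -
    \<comment> \<open>Monicity makes the two legs of a cone agree; the common leg is then its own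
      mediating arrow, since the projections are identities.\<close>
    have "f = g" and f: "f \<in> hom C (Dom C f) (Dom C m)"
      using fg mono by (auto simp: comm_square_def monomorphisms_def hom_def)
    moreover have "Dom C ?i = Dom C m"
      using i by (simp add: hom_def)
    ultimately show ?thesis
      using Id_Comp by (metis (no_types, lifting))
  qed
  with sq show "pullback C ?i ?i m m"
    unfolding pullback_def by blast
next
  assume pb: "pullback C ?i ?i m m"
  have "u = v" if "u \<in> Arr C" "v \<in> Arr C" "Dom C u = Dom C v" "Cod C u = Dom C m"
    "Cod C v = Dom C m" "Comp C m u = Comp C m v" for u v
  proof -
    \<comment> \<open>\<open>u\<close> and \<open>v\<close> form a cone; composing its mediating
      arrow with \<open>?i\<close> yields both of them.\<close>
    have "comm_square C u v m m"
      using that m by (auto simp: comm_square_def)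
    then show ?thesis
      using pb unfolding pullback_def by metis
  qed
  then show "m \<in> monomorphisms C"
    using m unfolding monomorphisms_def by blast
qed

section \<open>Functors on squares, isomorphisms and monomorphisms\<close>

context cat_functor
begin

lemma map_Arr:
  assumes "f \<in> Arr A"
  shows "arr_map F f \<in> Arr B" "Dom B (arr_map F f) = obj_map F (Dom A f)"
    "Cod B (arr_map F f) = obj_map F (Cod A f)"
  using map_hom[of f "Dom A f" "Cod A f"] assms by (auto simp: hom_def)

lemma map_Comp_Arr:
  assumes "f \<in> Arr A" "g \<in> Arr A" "Cod A f = Dom A g"
  shows "arr_map F (Comp A g f) = Comp B (arr_map F g) (arr_map F f)"
  using map_Comp[of f "Dom A f" "Cod A f" g "Cod A g"] assms by (auto simp: hom_def)

lemma map_comm_square: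
  assumes "comm_square A f m n g"
  shows "comm_square B (arr_map F f) (arr_map F m) (arr_map F n) (arr_map F g)"
  using assms map_Comp_Arr[of f n] map_Comp_Arr[of m g]
  by (auto simp: comm_square_def map_Arr)

lemma map_isomorphism:
  assumes "f \<in> isomorphisms A"
  shows "arr_map F f \<in> isomorphisms B"
proof -
  obtain g where f: "f \<in> Arr A" and g: "g \<in> hom A (Cod A f) (Dom A f)"
    and gf: "Comp A g f = Id A (Dom A f)" and fg: "Comp A f g = Id A (Cod A f)"
    using assms by (auto simp: isomorphisms_def)
  have g': "g \<in> Arr A" "Dom A g = Cod A f" "Cod A g = Dom A f"
    using g by (auto simp: hom_def)
  have "Comp B (arr_map F g) (arr_map F f) = Id B (obj_map F (Dom A f))"
    "Comp B (arr_map F f) (arr_map F g) = Id B (obj_map F (Cod A f))"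
    using map_Comp_Arr[of f g] map_Comp_Arr[of g f] f g' gf fg
      map_Id[OF A.dom_in_Ob[OF f]] map_Id[OF A.cod_in_Ob[OF f]] by simp_all
  then show ?thesis
    using f map_hom[OF g] by (auto simp: isomorphisms_def map_Arr)
qed

end

text \<open>Functors preserve identities, so the trivial square on \<open>m\<close> is sent to the
  trivial square on its image, a pullback by monicity there. Reflecting it gives the claim.\<close>

lemma jointly_reflects_monos:
  assumes "\<And>j. j \<in> J \<Longrightarrow> cat_functor A (B j) (F j)" "category A"
    and refl: "jointly_reflects_pullbacks J A B F (cospans A)"
    and m: "m \<in> Arr A" and mono: "\<And>j. j \<in> J \<Longrightarrow> arr_map (F j) m \<in> monomorphisms (B j)"
  shows "m \<in> monomorphisms A"
proof -
  interpret A: category A by fact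
  let ?i = "Id A (Dom A m)"
  have i: "?i \<in> hom A (Dom A m) (Dom A m)"
    using A.Id_in_hom A.dom_in_Ob m by blast
  have "comm_square A ?i ?i m m"
    using i m by (auto simp: comm_square_def hom_def)
  moreover have "pullback (B j) (arr_map (F j) ?i) (arr_map (F j) ?i) (arr_map (F j) m) (arr_map (F j) m)"
    if j: "j \<in> J" for j
  proof -
    interpret cat_functor A "B j" "F j" by (fact assms(1)[OF j])
    show ?thesis
      using B.mono_iff_pullback mono[OF j] m by (simp add: map_Arr map_Id A.dom_in_Ob)
  qed
  ultimately have "pullback A ?i ?i m m"
    using refl m by (auto simp: jointly_reflects_pullbacks_def cospans_def)
  then show ?thesis
    using A.mono_iff_pullback m by blast
qed

text \<open>The classes \<open>M\<close> and \<open>N\<close> are not fixed here, so that the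
  results below can also be instantiated with preimages of \<open>MB\<close> and
  \<open>NB\<close>.\<close>

locale adhesive_family =
  fixes A :: "('o, 'a) cat" and J :: "'j set" and B :: "'j \<Rightarrow> ('p, 'b) cat"
    and MB NB :: "'j \<Rightarrow> 'b set" and F :: "'j \<Rightarrow> ('o, 'a, 'p, 'b) cat_map"
  assumes category_A: "category A"
    and functors: "j \<in> J \<Longrightarrow> cat_functor A (B j) (F j)"
    and adhesive_B: "j \<in> J \<Longrightarrow> adhesive (B j) (MB j) (NB j)"
begin

section \<open>Stability and the Van Kampen property in the source category\<close>

lemma image_van_kampen:
  assumes "stability_hypotheses J A M N B MB NB F" "f \<in> N" "m \<in> M" "pushout A f m n g" "j \<in> J"
  shows "van_kampen (B j) (arr_map (F j) f) (arr_map (F j) m) (arr_map (F j) n) (arr_map (F j) g)"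
proof -
  have "(f, m) \<in> MN_spans A M N"
    using assms comm_square_spans[OF pushout_comm_square] by (simp add: MN_spans_def)
  then have po: "pushout (B j) (arr_map (F j) f) (arr_map (F j) m) (arr_map (F j) n) (arr_map (F j) g)"
    using assms unfolding stability_hypotheses_def jointly_preserves_pushouts_def by blast
  have "arr_map (F j) f \<in> NB j" "arr_map (F j) m \<in> MB j"
    using assms unfolding stability_hypotheses_def by blast+
  then have "(arr_map (F j) f, arr_map (F j) m) \<in> MN_spans (B j) (MB j) (NB j)"
    using comm_square_spans[OF pushout_comm_square[OF po]] by (simp add: MN_spans_def)
  then show ?thesis
    using adhesive_B[OF \<open>j \<in> J\<close>] po unfolding adhesive_def by blast
qed

lemma image_cube:
  assumes "comm_cube A f m n g f' m' n' g' a b c d" "j \<in> J"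
  shows "comm_cube (B j) (arr_map (F j) f) (arr_map (F j) m) (arr_map (F j) n) (arr_map (F j) g)
    (arr_map (F j) f') (arr_map (F j) m') (arr_map (F j) n') (arr_map (F j) g')
    (arr_map (F j) a) (arr_map (F j) b) (arr_map (F j) c) (arr_map (F j) d)"
  using assms cat_functor.map_comm_square[OF functors] by (simp add: comm_cube_def)

text \<open>In each \<open>B j\<close> the image cube has a Van Kampen bottom and four pullback
  sides, hence a pushout on top. The classes of \<open>f'\<close>, \<open>m'\<close> and
  \<open>n'\<close> allow this to be reflected.\<close>

lemma stable_pushouts:
  assumes adm: "admissible_classes A M N" and hyp: "stability_hypotheses J A M N B MB NB F"
    and f: "f \<in> N" and m: "m \<in> M" and po: "pushout A f m n g"
  shows "stable_pushout A f m n g"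
  unfolding stable_pushout_def
proof (intro conjI allI impI, fact po)
  fix f' m' n' g' a b c d
  assume cube: "comm_cube A f m n g f' m' n' g' a b c d"
    and pb: "pullback A f' a b f" "pullback A m' a c m" "pullback A n' b d n" "pullback A g' c d g"
  \<comment> \<open>Pushout stability carries \<open>M\<close> from \<open>m\<close> to
    \<open>n\<close>, and the face over \<open>n\<close> then carries it to
    \<open>n'\<close>.\<close>
  have "n \<in> M"
    using adm po m pushout_stable(1) unfolding admissible_classes_def by metis
  then have "m' \<in> M" "n' \<in> M" "f' \<in> N"
    using adm pb f m pullback_stable(2) unfolding admissible_classes_def by metis+
  moreover have "comm_square A f' m' n' g'"
    using cube by (simp add: comm_cube_def)
  moreover have "pushout (B j) (arr_map (F j) f') (arr_map (F j) m') (arr_map (F j) n') (arr_map (F j) g')"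
    if j: "j \<in> J" for j
  proof -
    have "preserves_pullbacks A (B j) (F j)"
      using hyp j unfolding stability_hypotheses_def by blast
    then show ?thesis
      using image_van_kampen[OF hyp f m po j] image_cube[OF cube j] pb
      unfolding van_kampen_def preserves_pullbacks_def by blast
  qed
  ultimately show "pushout A f' m' n' g'"
    using hyp unfolding stability_hypotheses_def by blast
qed

lemma van_kampen_pushouts:
  assumes adm: "admissible_classes A M N" and hyp: "stability_hypotheses J A M N B MB NB F"
    and refl: "reflects_MN_pullbacks J A M N B F"
    and f: "f \<in> N" and m: "m \<in> M" and po: "pushout A f m n g"
  shows "van_kampen A f m n g"
proof -
  have "pullback A n' b d n \<and> pullback A g' c d g"
    if cube: "comm_cube A f m n g f' m' n' g' a b c d"
      and pb: "pullback A f' a b f" "pullback A m' a c m" and top: "pushout A f' m' n' g'"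
    for f' m' n' g' a b c d
  proof -
    have "m' \<in> M" "f' \<in> N"
      using adm pb f m pullback_stable(2) unfolding admissible_classes_def by metis+
    have faces: "pullback (B j) (arr_map (F j) n') (arr_map (F j) b) (arr_map (F j) d) (arr_map (F j) n)"
      "pullback (B j) (arr_map (F j) g') (arr_map (F j) c) (arr_map (F j) d) (arr_map (F j) g)"
      if j: "j \<in> J" for j
    proof -
      have "preserves_pullbacks A (B j) (F j)"
        using hyp j unfolding stability_hypotheses_def by blast
      then have vertical: "pullback (B j) (arr_map (F j) f') (arr_map (F j) a) (arr_map (F j) b) (arr_map (F j) f)"
        "pullback (B j) (arr_map (F j) m') (arr_map (F j) a) (arr_map (F j) c) (arr_map (F j) m)"
        using pb unfolding preserves_pullbacks_def by blast+
      \<comment> \<open>By the classes of \<open>f'\<close> and \<open>m'\<close> the top face is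
        itself an \<open>M, N\<close>-pushout, so its image is a pushout and the Van Kampen property
        below applies in the direction towards pullbacks.\<close>
      have "pushout (B j) (arr_map (F j) f') (arr_map (F j) m') (arr_map (F j) n') (arr_map (F j) g')"
        using image_van_kampen[OF hyp \<open>f' \<in> N\<close> \<open>m' \<in> M\<close> top j] unfolding van_kampen_def by blast
      then show "pullback (B j) (arr_map (F j) n') (arr_map (F j) b) (arr_map (F j) d) (arr_map (F j) n)"
        "pullback (B j) (arr_map (F j) g') (arr_map (F j) c) (arr_map (F j) d) (arr_map (F j) g)"
        using image_van_kampen[OF hyp f m po j] image_cube[OF cube j] vertical
        unfolding van_kampen_def by blast+
    qed
    have sq: "comm_square A n' b d n" "comm_square A g' c d g"
      using cube by (simp_all add: comm_cube_def)
    \<comment> \<open>One front face has a cospan with a leg in \<open>M\<close>, the other one with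
      a leg in \<open>N\<close>; this is why both kinds of pullbacks have to be reflected.\<close>
    have "n \<in> M" "g \<in> N"
      using adm po f m pushout_stable unfolding admissible_classes_def by metis+
    then have "(d, n) \<in> leg_cospans A M" "(d, g) \<in> leg_cospans A N"
      using sq by (auto simp: leg_cospans_def cospans_def comm_square_def)
    then show ?thesis
      using refl sq faces unfolding reflects_MN_pullbacks_def jointly_reflects_pullbacks_def by blast
  qed
  then show ?thesis
    using stable_pushouts[OF adm hyp f m po] unfolding van_kampen_def stable_pushout_def by blast
qed

text \<open>The Van Kampen clause is already established. Preservation and reflection do not assert
  existence, so the pullbacks and pushouts enter as separate hypotheses.\<close>

lemma adhesive_of_creation:
  assumes "admissible_classes A M N" "stability_hypotheses J A M N B MB NB F"
    and "reflects_MN_pullbacks J A M N B F"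
    and "has_pullbacks A (leg_cospans A M)" "has_pushouts A (MN_spans A M N)"
  shows "adhesive A M N"
  using assms category_A van_kampen_pushouts[OF assms(1-3)]
  unfolding adhesive_def by (auto simp: MN_spans_def)

section \<open>Classes of arrows defined by their images\<close>

definition preimage :: "('j \<Rightarrow> 'b set) \<Rightarrow> 'a set" where
  "preimage X = {f \<in> Arr A. \<forall>j \<in> J. arr_map (F j) f \<in> X j}"

lemma isomorphisms_preimage:
  assumes "\<And>j. j \<in> J \<Longrightarrow> isomorphisms (B j) \<subseteq> X j"
  shows "isomorphisms A \<subseteq> preimage X"
  using assms cat_functor.map_isomorphism[OF functors]
  unfolding preimage_def by (auto simp: isomorphisms_def[of A] subset_iff)

lemma composition_preimage:
  assumes "\<And>j. j \<in> J \<Longrightarrow> closed_under_composition (B j) (X j)"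
  shows "closed_under_composition A (preimage X)"
  unfolding closed_under_composition_def
proof (intro ballI impI)
  fix f g
  assume fg: "f \<in> Arr A" "g \<in> Arr A" "Cod A f = Dom A g" and X: "f \<in> preimage X" "g \<in> preimage X"
  interpret category A by (fact category_A)
  have "Comp A g f \<in> Arr A"
    using Comp_in_hom[of f "Dom A f" "Cod A f" g "Cod A g"] fg by (simp add: hom_def)
  moreover have "arr_map (F j) (Comp A g f) \<in> X j" if j: "j \<in> J" for j
  proof -
    interpret cat_functor A "B j" "F j" by (fact functors[OF j])
    show ?thesis
      using fg X j assms[OF j]
      by (simp add: preimage_def closed_under_composition_def map_Comp_Arr map_Arr)
  qed
  ultimately show "Comp A g f \<in> preimage X"
    by (simp add: preimage_def)
qed

text \<open>Keeping \<open>X\<close> and \<open>Y\<close> apart lets one proof cover decomposition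
  of each class by itself and of \<open>preimage NB\<close> by \<open>preimage MB\<close>.\<close>

lemma decomposition_preimage:
  assumes "\<And>j. j \<in> J \<Longrightarrow> closed_under_decomposition_by (B j) (Y j) (X j)"
  shows "closed_under_decomposition_by A (preimage Y) (preimage X)"
  unfolding closed_under_decomposition_by_def
proof (intro ballI impI)
  fix f g
  assume fg: "f \<in> Arr A" "g \<in> Arr A" "Cod A f = Dom A g"
    and X: "Comp A g f \<in> preimage X" and Y: "g \<in> preimage Y"
  have "arr_map (F j) f \<in> X j" if j: "j \<in> J" for j
  proof -
    interpret cat_functor A "B j" "F j" by (fact functors[OF j])
    have "Comp (B j) (arr_map (F j) g) (arr_map (F j) f) \<in> X j"
      using X j map_Comp_Arr[OF fg] by (auto simp: preimage_def)
    then show ?thesis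
      using assms[OF j] fg map_Arr[OF fg(1)] map_Arr[OF fg(2)] Y j
      unfolding closed_under_decomposition_by_def preimage_def
      by (metis (no_types, lifting) mem_Collect_eq)
  qed
  with fg show "f \<in> preimage X"
    by (simp add: preimage_def)
qed

text \<open>Each \<open>F j\<close> sends the square to a pullback, where stability of
  \<open>X j\<close> moves membership from the image of \<open>n\<close> to that of
  \<open>m\<close>.\<close>

lemma stable_under_pullbacks_preimage:
  assumes "jointly_preserves_pullbacks J A B F (cospans A)"
    and "\<And>j. j \<in> J \<Longrightarrow> stable_under_pullbacks (B j) (X j)"
  shows "stable_under_pullbacks A (preimage X)"
  unfolding stable_under_pullbacks_def
proof (intro allI impI)
  fix f m n g
  assume pb: "pullback A f m n g" and n: "n \<in> preimage X"
  have sq: "comm_square A f m n g"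
    using pb by (rule pullback_comm_square)
  have "arr_map (F j) m \<in> X j" if j: "j \<in> J" for j
  proof (rule pullback_stable(1))
    show "stable_under_pullbacks (B j) (X j)"
      using assms(2) j .
    show "pullback (B j) (arr_map (F j) f) (arr_map (F j) m) (arr_map (F j) n) (arr_map (F j) g)"
      using assms(1) comm_square_cospans[OF sq] pb j
      unfolding jointly_preserves_pullbacks_def by blast
    show "arr_map (F j) n \<in> X j"
      using n j by (simp add: preimage_def)
  qed
  with sq show "m \<in> preimage X"
    by (simp add: preimage_def comm_square_def)
qed

lemma stable_under_pushouts_preimage:
  assumes "jointly_preserves_pushouts J A B F (spans A)"
    and "\<And>j. j \<in> J \<Longrightarrow> stable_under_pushouts (B j) (X j)"
  shows "stable_under_pushouts A (preimage X)"
  unfolding stable_under_pushouts_def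
proof (intro allI impI)
  fix f m n g
  assume po: "pushout A f m n g" and m: "m \<in> preimage X"
  have sq: "comm_square A f m n g"
    using po by (rule pushout_comm_square)
  have "arr_map (F j) n \<in> X j" if j: "j \<in> J" for j
  proof (rule pushout_stable(1))
    show "stable_under_pushouts (B j) (X j)"
      using assms(2) j .
    show "pushout (B j) (arr_map (F j) f) (arr_map (F j) m) (arr_map (F j) n) (arr_map (F j) g)"
      using assms(1) comm_square_spans[OF sq] po j
      unfolding jointly_preserves_pushouts_def by blast
    show "arr_map (F j) m \<in> X j"
      using m j by (simp add: preimage_def)
  qed
  with sq show "n \<in> preimage X"
    by (simp add: preimage_def comm_square_def)
qed

text \<open>The clauses are inherited from the \<open>B j\<close> one by one. Consisting of
  monomorphisms is the clause that uses reflection of pullbacks; the stability clauses use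
  preservation.\<close>

lemma admissible_preimages:
  assumes po: "jointly_creates_pushouts J A B F (spans A)"
    and pb: "jointly_creates_pullbacks J A B F (cospans A)"
  shows "admissible_classes A (preimage MB) (preimage NB)"
proof -
  have adm: "admissible_classes (B j) (MB j) (NB j)" if "j \<in> J" for j
    using adhesive_B[OF that] by (simp add: adhesive_def)
  have "preimage MB \<subseteq> monomorphisms A"
  proof
    fix m
    assume m: "m \<in> preimage MB"
    show "m \<in> monomorphisms A"
    proof (rule jointly_reflects_monos[OF functors category_A])
      show "jointly_reflects_pullbacks J A B F (cospans A)"
        using pb by (simp add: jointly_creates_pullbacks_def)
      show "m \<in> Arr A"
        using m by (simp add: preimage_def)
      show "arr_map (F j) m \<in> monomorphisms (B j)" if "j \<in> J" for j
        using adm[OF that] m that by (auto simp: admissible_classes_def preimage_def)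
    qed
  qed
  moreover have "preimage NB \<subseteq> Arr A"
    by (auto simp: preimage_def)
  moreover have "jointly_preserves_pushouts J A B F (spans A)"
    "jointly_preserves_pullbacks J A B F (cospans A)"
    using po pb by (simp_all add: jointly_creates_pushouts_def jointly_creates_pullbacks_def)
  ultimately show ?thesis
    using adm unfolding admissible_classes_def
    by (intro conjI isomorphisms_preimage composition_preimage decomposition_preimage
        stable_under_pullbacks_preimage stable_under_pushouts_preimage) simp_all
qed

lemma stability_hypotheses_preimages:
  assumes po: "jointly_creates_pushouts J A B F (spans A)"
    and pb: "jointly_creates_pullbacks J A B F (cospans A)"
  shows "stability_hypotheses J A (preimage MB) (preimage NB) B MB NB F"
  unfolding stability_hypotheses_def
proof (intro conjI ballI allI impI)
  show "preserves_pullbacks A (B j) (F j)" if "j \<in> J" for j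
    using pb that unfolding preserves_pullbacks_def jointly_creates_pullbacks_def
      jointly_preserves_pullbacks_def
    by (blast dest: pullback_comm_square comm_square_cospans)
  show "jointly_preserves_pushouts J A B F (MN_spans A (preimage MB) (preimage NB))"
    using po unfolding jointly_creates_pushouts_def jointly_preserves_pushouts_def
    by (auto simp: MN_spans_def)
  show "pushout A f m n g"
    if "comm_square A f m n g" "\<forall>j \<in> J. pushout (B j) (arr_map (F j) f) (arr_map (F j) m)
      (arr_map (F j) n) (arr_map (F j) g)" for f m n g
    using po that comm_square_spans[OF that(1)]
    unfolding jointly_creates_pushouts_def jointly_reflects_pushouts_def by blast
\<comment> \<open>What remains is that \<open>F j\<close> maps the preimages into
  \<open>MB j\<close> and \<open>NB j\<close>.\<close>
qed (auto simp: preimage_def)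

text \<open>Creation for all spans and cospans restricts to those with legs in the preimages, which
  reduces the claim to \<open>adhesive_of_creation\<close>.\<close>

lemma adhesive_preimages:
  assumes po: "jointly_creates_pushouts J A B F (spans A)"
    and pb: "jointly_creates_pullbacks J A B F (cospans A)"
  shows "adhesive A (preimage MB) (preimage NB)"
proof (rule adhesive_of_creation)
  show "reflects_MN_pullbacks J A (preimage MB) (preimage NB) B F"
    using pb unfolding jointly_creates_pullbacks_def reflects_MN_pullbacks_def
      jointly_reflects_pullbacks_def by (auto simp: leg_cospans_def)
  show "has_pullbacks A (leg_cospans A (preimage MB))"
    using pb unfolding jointly_creates_pullbacks_def has_pullbacks_def
    by (auto simp: leg_cospans_def)
  show "has_pushouts A (MN_spans A (preimage MB) (preimage NB))"
    using po unfolding jointly_creates_pushouts_def has_pushouts_def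
    by (auto simp: MN_spans_def)
qed (fact admissible_preimages[OF po pb] stability_hypotheses_preimages[OF po pb])+

end

theorem theorem2p10:
  fixes A :: "('o, 'a) cat" and M N :: "'a set"
    and J :: "'j set" and B :: "'j \<Rightarrow> ('p, 'b) cat" and MB NB :: "'j \<Rightarrow> 'b set"
    and F :: "'j \<Rightarrow> ('o, 'a, 'p, 'b) cat_map"
  assumes "category A"
    and "admissible_classes A M N"
    and "J \<noteq> {}"
    and "\<And>j. j \<in> J \<Longrightarrow> cat_functor A (B j) (F j)"
    and "\<And>j. j \<in> J \<Longrightarrow> adhesive (B j) (MB j) (NB j)"
  shows
    "(stability_hypotheses J A M N B MB NB F \<longrightarrow>
        (\<forall>(f, m) \<in> MN_spans A M N. \<forall>n g. pushout A f m n g \<longrightarrow> stable_pushout A f m n g) \<and>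
        (reflects_MN_pullbacks J A M N B F \<longrightarrow>
          (\<forall>(f, m) \<in> MN_spans A M N. \<forall>n g. pushout A f m n g \<longrightarrow> van_kampen A f m n g))) \<and>
     (stability_hypotheses J A M N B MB NB F \<and> reflects_MN_pullbacks J A M N B F \<and>
        jointly_creates_pullbacks J A B F (leg_cospans A M) \<and>
        jointly_creates_pullbacks J A B F (leg_cospans A N) \<and>
        has_pushouts A (MN_spans A M N) \<longrightarrow>
        adhesive A M N) \<and>
     (jointly_creates_pushouts J A B F (spans A) \<and>
        jointly_creates_pullbacks J A B F (cospans A) \<longrightarrow>
        adhesive A {m \<in> Arr A. \<forall>j \<in> J. arr_map (F j) m \<in> MB j}
                   {n \<in> Arr A. \<forall>j \<in> J. arr_map (F j) n \<in> NB j})"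
proof -
  interpret adhesive_family A J B MB NB F
    using assms(1,4,5) by (rule adhesive_family.intro)
  note adm = assms(2)
  show ?thesis
    \<comment> \<open>The comprehensions in the last item are \<open>preimage MB\<close> and
      \<open>preimage NB\<close>; in the middle item the pullbacks exist because creation includes
      existence.\<close>
    using stable_pushouts[OF adm] van_kampen_pushouts[OF adm] adhesive_of_creation[OF adm]
      adhesive_preimages
    unfolding preimage_def
    by (auto simp: MN_spans_def jointly_creates_pullbacks_def)
qed

end
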